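(* Let $N_f$ be an odd positive integer and put $\tilde N_f = N_f + 1$. Consider a sequence of networks $G_1, G_2, \dots$ with node counts $N_k = N_{k-1}+1$ for $k \ge 2$, where $N_f < N_k - 2$ for all $k$. Together with the networks, maintain an auxiliary cycle $C_k$ whose node set is the node set of $G_k$ ($C_k$ is bookkeeping only; its links are not necessarily links of $G_k$). Let $G_1$ be the network on the $N_1$ nodes of $C_1$ in which every node is linked to every node within distance $\tilde N_f/2$ along $C_1$. For $k \ge 2$, obtain $G_k$ from $G_{k-1}$ as follows: (i) form $C_k$ from $C_{k-1}$ by inserting the new node between any two adjacent nodes of $C_{k-1}$; (ii) link the new node to all nodes within distance $\tilde N_f/2$ of it along $C_k$; no other links are added or removed. Then $G_i$ is a subnetwork of $G_j$ for all $i \le j$, every $G_k$ is $N_f$-robust, and the number of links $L_k$ of $G_k$ satisfies $L_k \le N_k(N_f+1)$.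
   Context: A network is a finite simple undirected graph; links are edges. For an integer $N_f$, a network $G$ is $N_f$-robust if for every set $S$ of $N_f$ nodes of $G$, the network obtained by deleting the nodes of $S$ and their incident links is connected. The distance along a cycle between two of its nodes is the number of edges of the shorter of the two paths in the cycle between them. *)

theory Defs
  imports "Graph_Theory.Graph_Theory"
begin

text \<open>
  A finite simple undirected graph is a \<^locale>\<open>pair_graph\<close>: finite, loop-free, with a
  symmetric set of arcs. A link is a pair of opposite arcs, so it is counted as the
  two-element set of its end points.
\<close>

definition links :: "'a pair_pre_digraph \<Rightarrow> 'a set set" where
  "links G = {{u, v} | u v. (u, v) \<in> parcs G}"

definition robust :: "nat \<Rightarrow> 'a pair_pre_digraph \<Rightarrow> bool" where
  "robust Nf G \<longleftrightarrow>
     (\<forall>S. S \<subseteq> pverts G \<and> card S = Nf \<longrightarrow>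
        Digraph_Component.connected (with_proj G \<restriction> (pverts G - S)))"

text \<open>
  The library predicate \<^const>\<open>pre_digraph.cycle\<close> on arc lists admits going back and forth along
  one link; the length bound excludes this.
\<close>

definition cycle_graph :: "'a pair_pre_digraph \<Rightarrow> bool" where
  "cycle_graph C \<longleftrightarrow> pair_graph C \<and>
     (\<exists>p. pre_digraph.cycle (with_proj C) p \<and> 3 \<le> length p \<and>
          pverts C = fst ` set p \<and> parcs C = set p \<union> (set p)\<inverse>)"

text \<open>
  Between two distinct nodes of a cycle there are exactly two paths (walks without repeated
  nodes); between a node and itself only the empty one.
\<close>

definition cycle_dist :: "'a pair_pre_digraph \<Rightarrow> 'a \<Rightarrow> 'a \<Rightarrow> nat" where
  "cycle_dist C u v = (LEAST n. \<exists>p. pre_digraph.apath (with_proj C) u p v \<and> length p = n)"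

definition near :: "nat \<Rightarrow> 'a pair_pre_digraph \<Rightarrow> 'a \<Rightarrow> 'a set" where
  "near d C u = {v \<in> pverts C. v \<noteq> u \<and> cycle_dist C u v \<le> d}"

definition ring_network :: "nat \<Rightarrow> 'a pair_pre_digraph \<Rightarrow> 'a pair_pre_digraph" where
  "ring_network d C =
     \<lparr> pverts = pverts C, parcs = {(u, v). u \<in> pverts C \<and> v \<in> near d C u} \<rparr>"

text \<open>
  Inserting a node \<open>x\<close> between the adjacent nodes \<open>a\<close> and \<open>b\<close> of the cycle is the subdivision
  of the link between \<open>a\<close> and \<open>b\<close>.
\<close>

definition growth_step ::
  "nat \<Rightarrow> 'a pair_pre_digraph \<Rightarrow> 'a pair_pre_digraph \<Rightarrow>
     'a pair_pre_digraph \<Rightarrow> 'a pair_pre_digraph \<Rightarrow> bool" where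
  "growth_step d C G C' G' \<longleftrightarrow>
     (\<exists>x a b. x \<notin> pverts C \<and> (a, b) \<in> parcs C \<and> C' = subdivide C (a, b) x \<and>
        G' = \<lparr> pverts = insert x (pverts G),
               parcs = parcs G \<union> {x} \<times> near d C' x \<union> near d C' x \<times> {x} \<rparr>)"

end

theory Submission
  imports Defs
begin

text \<open>
  With \<open>2d = N\<^sub>f + 1\<close>, every network of the sequence stays connected under the deletion of fewer
  than \<open>2d\<close> nodes. In the initial ring network two surviving nodes cut the cycle into two arcs;
  one of them contains fewer than \<open>d\<close> deleted nodes, so consecutive survivors on it are at distance
  at most \<open>d\<close> and hence linked. Each further node is attached to exactly \<open>2d\<close> old nodes, one of
  which survives; this preserves the property and adds only \<open>2d\<close> links.

  Along the cycle, nodes are indexed periodically by the integers; nearness is then a bound on the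
  difference of indices.
\<close>

subsection \<open>Vertex connectivity\<close>

abbreviation connected_on :: "'a pair_pre_digraph \<Rightarrow> 'a set \<Rightarrow> bool" where
  "connected_on G W \<equiv> Digraph_Component.connected (with_proj G \<restriction> W)"

definition vertex_connected :: "nat \<Rightarrow> 'a pair_pre_digraph \<Rightarrow> bool" where
  "vertex_connected m G \<longleftrightarrow> m < card (pverts G) \<and>
     (\<forall>S. finite S \<and> card S < m \<longrightarrow> connected_on G (pverts G - S))"

lemma vertex_connected_imp_robust:
  assumes "vertex_connected (Suc m) G"
  shows "robust m G"
proof -
  have "finite (pverts G)"
    using assms by (auto simp: vertex_connected_def intro: card_ge_0_finite)
  then show ?thesis
    using assms by (auto simp: robust_def vertex_connected_def dest: finite_subset)
qed

lemma sym_rtrancl_on_symcl: "sym (rtrancl_on W (symcl r))"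
  by (intro rtrancl_on_sym symI) (auto simp: symcl_def)

lemma connected_on_iff:
  "connected_on G W \<longleftrightarrow>
     W \<noteq> {} \<and> (\<forall>u\<in>W. \<forall>v\<in>W. (u, v) \<in> rtrancl_on W (symcl (parcs G)))"
proof -
  have arcs: "symcl (arcs_ends (with_proj G \<restriction> W)) = Restr (symcl (parcs G)) W"
    by (auto simp: symcl_def arcs_ends_conv)
  have "rtrancl_on W (Restr (symcl (parcs G)) W) = rtrancl_on W (symcl (parcs G))"
    (is "?L = ?R")
  proof (intro equalityI subrelI)
    fix u v assume "(u, v) \<in> ?R"
    then show "(u, v) \<in> ?L"
      by induction (auto intro: converse_rtrancl_on_into_rtrancl_on)
  qed (auto elim: rtrancl_on_mono[rotated 2])
  then show ?thesis by (simp add: Digraph_Component.connected_conv arcs)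
qed

lemma connected_on_mono:
  assumes "connected_on G W" "parcs G \<subseteq> parcs H"
  shows "connected_on H W"
proof -
  have "symcl (parcs G) \<subseteq> symcl (parcs H)" using assms(2) by (auto simp: symcl_def)
  then show ?thesis
    using assms(1) unfolding connected_on_iff by (blast intro: rtrancl_on_mono)
qed

lemma connected_on_insert:
  assumes "connected_on G W" "t \<in> W" "(x, t) \<in> parcs G"
  shows "connected_on G (insert x W)"
proof -
  let ?R = "rtrancl_on (insert x W) (symcl (parcs G))"
  have "(u, t) \<in> ?R" if "u \<in> insert x W" for u
  proof (cases "u = x")
    case True
    then show ?thesis
      using assms(2,3)
      by (auto simp: symcl_def intro: converse_rtrancl_on_into_rtrancl_on)
  next
    case False
    then have "(u, t) \<in> rtrancl_on W (symcl (parcs G))"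
      using assms(1,2) that by (auto simp: connected_on_iff)
    then show ?thesis by (rule rtrancl_on_mono[rotated 2]) auto
  qed
  moreover have "sym ?R" by (rule sym_rtrancl_on_symcl)
  ultimately show ?thesis
    unfolding connected_on_iff by (blast intro: rtrancl_on_trans dest: symD)
qed

definition attach_vertex :: "'a \<Rightarrow> 'a set \<Rightarrow> 'a pair_pre_digraph \<Rightarrow> 'a pair_pre_digraph" where
  "attach_vertex x T G =
     \<lparr> pverts = insert x (pverts G), parcs = parcs G \<union> {x} \<times> T \<union> T \<times> {x} \<rparr>"

lemma attach_vertex_simps [simp]:
  "pverts (attach_vertex x T G) = insert x (pverts G)"
  "parcs (attach_vertex x T G) = parcs G \<union> {x} \<times> T \<union> T \<times> {x}"
  by (simp_all add: attach_vertex_def)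

lemma vertex_connected_attach_vertex:
  assumes "vertex_connected m G" "T \<subseteq> pverts G" "m \<le> card T"
  shows "vertex_connected m (attach_vertex x T G)"
  unfolding vertex_connected_def
proof (intro conjI allI impI; (elim conjE)?)
  show "m < card (pverts (attach_vertex x T G))"
    using assms(1) card_insert_le[of "pverts G" x] by (simp add: vertex_connected_def)
next
  fix S :: "'a set" assume S: "finite S" "card S < m"
  let ?G' = "attach_vertex x T G"
  have "connected_on G (pverts G - S)"
    using assms(1) S by (simp add: vertex_connected_def)
  then have old: "connected_on ?G' (pverts G - S)"
    by (rule connected_on_mono) auto
  have "\<not> T \<subseteq> S" using S assms(3) card_mono[of S T] by auto
  then obtain t where t: "t \<in> T" "t \<notin> S" by blast
  show "connected_on ?G' (pverts ?G' - S)"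
  proof (cases "x \<in> S")
    case True
    then show ?thesis using old by simp
  next
    case False
    have "connected_on ?G' (insert x (pverts G - S))"
      using old by (rule connected_on_insert) (use t assms(2) in auto)
    then show ?thesis using False by (simp add: insert_Diff_if)
  qed
qed

lemma card_links_attach_vertex_le:
  assumes "finite T"
  shows "card (links (attach_vertex x T G)) \<le> card (links G) + card T"
proof -
  have "links (attach_vertex x T G) = links G \<union> (\<lambda>t. {x, t}) ` T"
    by (auto simp: links_def)
  then have "card (links (attach_vertex x T G)) \<le> card (links G) + card ((\<lambda>t. {x, t}) ` T)"
    by (simp add: card_Un_le)
  also have "\<dots> \<le> card (links G) + card T"
    using assms by (simp add: card_image_le)
  finally show ?thesis .
qed

subsection \<open>Cycles as lists of nodes\<close>

lemma pcas_iff: "pcas u p v \<longleftrightarrow> u # map snd p = map fst p @ [v]"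
  by (induction p arbitrary: u) auto

lemma pawalk_verts_eq_Cons: "pcas u p v \<Longrightarrow> pawalk_verts u p = u # map snd p"
  by (induction p arbitrary: u) auto

lemma map_snd_closed_pcas:
  assumes "pcas u p u" "p \<noteq> []"
  shows "map snd p = rotate1 (map fst p)"
  using assms by (cases p) (auto simp: pcas_iff)

abbreviation cyclic_pairs :: "'a list \<Rightarrow> ('a \<times> 'a) set" where
  "cyclic_pairs vs \<equiv> set (zip vs (rotate1 vs))"

definition cycle_on :: "'a list \<Rightarrow> 'a pair_pre_digraph" where
  "cycle_on vs =
     \<lparr> pverts = set vs, parcs = cyclic_pairs vs \<union> (cyclic_pairs vs)\<inverse> \<rparr>"

lemma pverts_cycle_on [simp]: "pverts (cycle_on vs) = set vs"
  by (simp add: cycle_on_def)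

lemma pair_graph_cycle_on:
  assumes "distinct vs" "2 \<le> length vs"
  shows "pair_graph (cycle_on vs)"
proof -
  have "rotate1 vs ! i \<noteq> vs ! i" if "i < length vs" for i
  proof -
    have "Suc i mod length vs \<noteq> i" "Suc i mod length vs < length vs"
      using assms(2) that by (cases "Suc i = length vs"; auto)+
    then show ?thesis using assms(1) that by (simp add: nth_rotate1 nth_eq_iff_index_eq)
  qed
  then have loopfree: "a \<noteq> b" if "(a, b) \<in> cyclic_pairs vs" for a b
    using that unfolding set_zip by fastforce
  show ?thesis
  proof unfold_locales
    fix e assume "e \<in> parcs (cycle_on vs)"
    then show "fst e \<in> pverts (cycle_on vs)" "snd e \<in> pverts (cycle_on vs)" "fst e \<noteq> snd e"
      by (cases e; auto simp: cycle_on_def dest: set_zip_leftD set_zip_rightD loopfree)+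
  qed (auto simp: cycle_on_def symmetric_def intro: symI)
qed

lemma cycle_graphE:
  assumes "cycle_graph C"
  obtains vs where "distinct vs" "3 \<le> length vs" "C = cycle_on vs"
proof -
  obtain p u where closed: "pcas u p u" and distinct_verts: "distinct (tl (pawalk_verts u p))"
    and length: "3 \<le> length p"
    and C: "pverts C = fst ` set p" "parcs C = set p \<union> (set p)\<inverse>"
    using assms by (auto simp: cycle_graph_def pre_digraph.cycle_def pre_digraph.awalk_def
        cas_with_proj_eq awalk_verts_with_proj_eq)
  let ?vs = "map fst p"
  have "p \<noteq> []" using length by auto
  then have snd_p: "map snd p = rotate1 ?vs" using closed by (rule map_snd_closed_pcas[rotated])
  then have "zip ?vs (rotate1 ?vs) = p" by (metis zip_map_fst_snd)
  then have "C = cycle_on ?vs" using C by (simp add: cycle_on_def)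
  moreover have "distinct ?vs"
    using distinct_verts by (simp add: pawalk_verts_eq_Cons[OF closed] snd_p)
  ultimately show thesis using that length by simp
qed

lemma cycle_graph_cycle_on:
  assumes "distinct vs" "3 \<le> length vs"
  shows "cycle_graph (cycle_on vs)"
proof -
  define p where "p = zip vs (rotate1 vs)"
  have fst_p: "map fst p = vs" and snd_p: "map snd p = rotate1 vs" by (simp_all add: p_def)
  have "vs \<noteq> []" using assms(2) by auto
  then have closed: "pcas (hd vs) p (hd vs)"
    by (simp add: pcas_iff fst_p snd_p rotate1_hd_tl flip: append_Cons)
  have "pre_digraph.cycle (with_proj (cycle_on vs)) p"
    unfolding pre_digraph.cycle_def pre_digraph.awalk_def cas_with_proj_eq awalk_verts_with_proj_eq
  proof (intro exI[of _ "hd vs"] conjI)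
    show "hd vs \<in> verts (with_proj (cycle_on vs))" using \<open>vs \<noteq> []\<close> by simp
    show "set p \<subseteq> arcs (with_proj (cycle_on vs))" by (simp add: cycle_on_def p_def)
    show "distinct (tl (pawalk_verts (hd vs) p))"
      using assms(1) by (simp add: pawalk_verts_eq_Cons[OF closed] snd_p)
    show "p \<noteq> []" using \<open>vs \<noteq> []\<close> fst_p by auto
  qed (fact closed)
  moreover have "3 \<le> length p" using assms(2) by (simp add: p_def)
  moreover have "pverts (cycle_on vs) = fst ` set p"
    using fst_p by (simp flip: set_map)
  moreover have "parcs (cycle_on vs) = set p \<union> (set p)\<inverse>" by (simp add: cycle_on_def p_def)
  ultimately show ?thesis
    using pair_graph_cycle_on[of vs] assms unfolding cycle_graph_def by auto
qed

lemma finite_pverts_cycle_graph: "cycle_graph C \<Longrightarrow> finite (pverts C)"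
  by (auto elim: cycle_graphE)

lemma zip_rotate1:
  "length xs = length ys \<Longrightarrow> zip (rotate1 xs) (rotate1 ys) = rotate1 (zip xs ys)"
  by (cases xs; cases ys) auto

lemma cycle_on_rotate: "cycle_on (rotate k vs) = cycle_on vs"
proof (induction k)
  case (Suc k)
  have "cycle_on (rotate1 ws) = cycle_on ws" for ws :: "'a list"
    by (simp add: cycle_on_def zip_rotate1)
  then show ?case using Suc by simp
qed simp

lemma subdivide_cycle_on:
  assumes "distinct vs" "3 \<le> length vs"
  shows "subdivide (cycle_on vs) (last vs, hd vs) x = cycle_on (vs @ [x])"
proof -
  obtain a us b where vs: "vs = a # us @ [b]"
    using assms(2) by (cases vs; cases "tl vs" rule: rev_cases) auto
  let ?Z = "set (zip (a # us) (us @ [b]))"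
  have zip_snoc: "zip (xs @ [c]) (ys @ [e]) = zip xs ys @ [(c, e)]"
    if "length xs = length ys" for xs ys :: "'a list" and c e
    using that by simp
  have "cyclic_pairs vs = insert (b, a) ?Z"
    using zip_snoc[of "a # us" "us @ [b]" b a] by (simp add: vs)
  moreover have "cyclic_pairs (vs @ [x]) = {(b, x), (x, a)} \<union> ?Z"
    using zip_snoc[of "a # us @ [b]" "us @ [b, x]" x a] zip_snoc[of "a # us" "us @ [b]" b x]
    by (simp add: vs insert_commute)
  moreover have "(b, a) \<notin> ?Z" "(a, b) \<notin> ?Z"
    using assms by (cases us; auto simp: vs dest: set_zip_leftD set_zip_rightD)+
  ultimately show ?thesis
    by (auto simp: cycle_on_def vs subdivide.simps)
qed

lemma ex_rotate_last_hd:
  assumes "(a, b) \<in> cyclic_pairs vs"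
  shows "\<exists>k. last (rotate k vs) = a \<and> hd (rotate k vs) = b"
proof -
  obtain i where i: "i < length vs" "a = vs ! i" "b = vs ! (Suc i mod length vs)"
    using assms by (auto simp: set_zip nth_rotate1)
  then have "vs \<noteq> []" by auto
  then have "last (rotate (Suc i) vs) = hd (rotate i vs)"
    by (simp add: rotate1_hd_tl)
  then show ?thesis
    using i \<open>vs \<noteq> []\<close>
    by (intro exI[of _ "Suc i"]) (simp add: hd_rotate_conv_nth del: rotate_Suc)
qed

lemma cycle_graph_subdivide:
  assumes "cycle_graph C" "(a, b) \<in> parcs C" "x \<notin> pverts C"
  shows "cycle_graph (subdivide C (a, b) x)"
proof -
  obtain vs where vs: "distinct vs" "3 \<le> length vs" and C: "C = cycle_on vs"
    using assms(1) by (rule cycle_graphE)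
  have subdivide: "cycle_graph (subdivide C (c, e) x)" if pair: "(c, e) \<in> cyclic_pairs vs" for c e
  proof -
    obtain k where "last (rotate k vs) = c" "hd (rotate k vs) = e"
      using ex_rotate_last_hd[OF pair] by blast
    then have "subdivide C (c, e) x = cycle_on (rotate k vs @ [x])"
      using subdivide_cycle_on[of "rotate k vs" x] vs by (simp add: C cycle_on_rotate)
    moreover have "distinct (rotate k vs @ [x])" using vs(1) assms(3) by (simp add: C)
    ultimately show ?thesis using vs(2) by (simp add: cycle_graph_cycle_on)
  qed
  have "subdivide C (a, b) x = subdivide C (b, a) x"
    by (auto simp: subdivide.simps)
  then show ?thesis
    using assms(2) subdivide[of a b] subdivide[of b a] by (auto simp: C cycle_on_def)
qed

subsection \<open>Nearness in terms of indices\<close>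

lemma (in pair_wf_digraph) cycle_dist_le_iff:
  assumes "u \<rightarrow>\<^sup>*\<^bsub>with_proj G\<^esub> v"
  shows "cycle_dist G u v \<le> d \<longleftrightarrow> (\<exists>p. awalk u p v \<and> length p \<le> d)"
proof
  obtain q where "apath u q v" using assms by (auto simp: reachable_apath)
  then have "\<exists>n p. apath u p v \<and> length p = n" by blast
  from LeastI_ex[OF this] obtain p where "apath u p v" "length p = cycle_dist G u v"
    unfolding cycle_dist_def by blast
  moreover assume "cycle_dist G u v \<le> d"
  ultimately show "\<exists>p. awalk u p v \<and> length p \<le> d"
    by (auto dest: awalkI_apath)
next
  assume "\<exists>p. awalk u p v \<and> length p \<le> d"
  then obtain p where p: "awalk u p v" "length p \<le> d" by blast
  let ?q = "awalk_to_apath p"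
  have q: "apath u ?q v" using p(1) by (rule apath_awalk_to_apath)
  then have "distinct ?q"
    by (auto simp: apath_def intro: distinct_verts_imp_distinct)
  then have "length ?q = card (set ?q)" by (simp add: distinct_card)
  also have "\<dots> \<le> card (set p)" using p(1) by (intro card_mono awalk_to_apath_subset) auto
  also have "\<dots> \<le> length p" by (rule card_length)
  finally have "length ?q \<le> d" using p(2) by simp
  moreover have "cycle_dist G u v \<le> length ?q"
    unfolding cycle_dist_def using q by (intro Least_le) blast
  ultimately show "cycle_dist G u v \<le> d" by simp
qed

locale distinct_cycle =
  fixes vs :: "'a list"
  assumes distinct: "distinct vs" and not_Nil: "vs \<noteq> []"

sublocale distinct_cycle \<subseteq> pair_wf_digraph "cycle_on vs"
  by unfold_locales (auto simp: cycle_on_def dest: set_zip_leftD set_zip_rightD)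

context distinct_cycle
begin

definition node :: "int \<Rightarrow> 'a" where
  "node i = vs ! nat (i mod int (length vs))"

lemma node_eq_iff: "node i = node j \<longleftrightarrow> int (length vs) dvd i - j"
proof -
  have "nat (k mod int (length vs)) < length vs" for k
    using not_Nil by (simp add: nat_less_iff)
  then have "node i = node j \<longleftrightarrow> i mod int (length vs) = j mod int (length vs)"
    using distinct not_Nil by (simp add: node_def nth_eq_iff_index_eq eq_nat_nat_iff)
  then show ?thesis by (simp add: mod_eq_dvd_iff)
qed

lemma node_add_cong: "node i = node j \<Longrightarrow> node (i + k) = node (j + k)"
  by (simp add: node_eq_iff)

lemma node_of_nat: "node (int k) = vs ! (k mod length vs)"
  by (simp add: node_def nat_mod_distrib)

lemma inj_on_node: "b \<le> a + int (length vs) \<Longrightarrow> inj_on node {a..<b}"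
proof (rule inj_onI)
  fix i j
  assume b: "b \<le> a + int (length vs)" and ij: "i \<in> {a..<b}" "j \<in> {a..<b}" "node i = node j"
  then have "int (length vs) dvd i - j" "\<bar>i - j\<bar> < int (length vs)"
    by (auto simp: node_eq_iff)
  then show "i = j" using dvd_imp_le_int[of "i - j" "int (length vs)"] by linarith
qed

lemma node_image_period: "node ` {a..<a + int (length vs)} = set vs"
proof (rule card_subset_eq)
  show "node ` {a..<a + int (length vs)} \<subseteq> set vs"
    using not_Nil by (auto simp: node_def nat_less_iff intro!: nth_mem)
  show "card (node ` {a..<a + int (length vs)}) = card (set vs)"
    by (simp add: card_image inj_on_node distinct_card distinct)
qed simp

lemma node_mem: "node i \<in> set vs"
  using node_image_period[of i] not_Nil by auto

lemma nodeE:
  assumes "v \<in> set vs"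
  obtains j where "v = node j" "i \<le> j" "j < i + int (length vs)"
proof -
  have "v \<in> node ` {i..<i + int (length vs)}" using assms by (simp only: node_image_period)
  then show thesis using that by auto
qed

lemma cyclic_pairs_eq_range_node: "cyclic_pairs vs = range (\<lambda>i. (node i, node (i + 1)))"
proof -
  have nth: "(vs ! k, rotate1 vs ! k) = (node (int k), node (int k + 1))" if "k < length vs" for k
    using that node_of_nat[of k] node_of_nat[of "Suc k"] by (simp add: nth_rotate1 add.commute)
  have "(node i, node (i + 1)) \<in> cyclic_pairs vs" for i
  proof -
    define k where "k = nat (i mod int (length vs))"
    have k: "k < length vs" "int k = i mod int (length vs)"
      using not_Nil by (simp_all add: k_def nat_less_iff)
    then have "node i = node (int k)" by (simp add: node_eq_iff dvd_minus_mod)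
    then have "node (i + 1) = node (int k + 1)" by (rule node_add_cong)
    with \<open>node i = node (int k)\<close> have "(node i, node (i + 1)) = (vs ! k, rotate1 vs ! k)"
      by (simp only: nth[OF k(1)])
    then show ?thesis using k(1) by (auto simp: set_zip)
  qed
  then show ?thesis by (auto simp: set_zip nth)
qed

lemma node_arc_iff: "(node i, v) \<in> parcs (cycle_on vs) \<longleftrightarrow> v = node (i + 1) \<or> v = node (i - 1)"
proof
  assume "(node i, v) \<in> parcs (cycle_on vs)"
  then consider (forward) k where "node i = node k" "v = node (k + 1)"
    | (backward) k where "node i = node (k + 1)" "v = node k"
    by (auto simp: cycle_on_def cyclic_pairs_eq_range_node)
  then show "v = node (i + 1) \<or> v = node (i - 1)"
  proof cases
    case forward
    then have "v = node (i + 1)" using node_add_cong[of i k 1] by simp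
    then show ?thesis ..
  next
    case backward
    then have "v = node (i - 1)" using node_add_cong[of i "k + 1" "- 1"] by simp
    then show ?thesis ..
  qed
next
  have "(node j, node (j + 1)) \<in> cyclic_pairs vs" for j
    unfolding cyclic_pairs_eq_range_node by blast
  from this[of i] this[of "i - 1"]
  show "(node i, v) \<in> parcs (cycle_on vs)" if "v = node (i + 1) \<or> v = node (i - 1)"
    using that by (auto simp: cycle_on_def)
qed

lemma awalk_node_imp_displacement_le:
  "awalk (node i) p v \<Longrightarrow> \<exists>j. v = node j \<and> \<bar>j - i\<bar> \<le> int (length p)"
proof (induction p arbitrary: i)
  case Nil
  then show ?case by (intro exI[of _ i]) (simp add: awalk_Nil_iff)
next
  case (Cons e p)
  then have "(node i, snd e) \<in> parcs (cycle_on vs)" "awalk (snd e) p v"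
    by (auto simp: awalk_Cons_iff)
  then obtain k where k: "snd e = node k" "\<bar>k - i\<bar> = 1"
    by (auto simp: node_arc_iff)
  then obtain j where "v = node j" "\<bar>j - k\<bar> \<le> int (length p)"
    using Cons.IH[of k] \<open>awalk (snd e) p v\<close> by auto
  then show ?case using k(2) by (intro exI[of _ j]) auto
qed

lemma ex_awalk_node: "\<exists>p. awalk (node i) p (node j) \<and> int (length p) = \<bar>j - i\<bar>"
proof (induction "nat \<bar>j - i\<bar>" arbitrary: i)
  case 0
  then show ?case by (intro exI[of _ "[]"]) (simp add: awalk_Nil_iff node_mem)
next
  case (Suc m)
  define k where "k = i + sgn (j - i)"
  have k: "m = nat \<bar>j - k\<bar>" "\<bar>j - i\<bar> = \<bar>j - k\<bar> + 1" "k = i + 1 \<or> k = i - 1"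
    using Suc.hyps(2) by (auto simp: k_def sgn_if)
  obtain p where "awalk (node k) p (node j)" "int (length p) = \<bar>j - k\<bar>"
    using Suc.hyps(1)[OF k(1)] by blast
  moreover have "(node i, node k) \<in> parcs (cycle_on vs)"
    using k(3) by (auto simp: node_arc_iff)
  ultimately show ?case
    using k(2) by (intro exI[of _ "(node i, node k) # p"]) (simp add: awalk_Cons_iff node_mem)
qed

lemma ex_awalk_node_length_le_iff:
  "(\<exists>p. awalk (node i) p v \<and> length p \<le> d) \<longleftrightarrow> v \<in> node ` {i - int d..i + int d}"
proof
  assume "\<exists>p. awalk (node i) p v \<and> length p \<le> d"
  then obtain p where p: "awalk (node i) p v" "length p \<le> d" by blast
  obtain j where "v = node j" "\<bar>j - i\<bar> \<le> int (length p)"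
    using awalk_node_imp_displacement_le[OF p(1)] by blast
  then show "v \<in> node ` {i - int d..i + int d}"
    using p(2) by (intro image_eqI[of v node j]) auto
next
  assume "v \<in> node ` {i - int d..i + int d}"
  then obtain j where "v = node j" "\<bar>j - i\<bar> \<le> int d" by auto
  then show "\<exists>p. awalk (node i) p v \<and> length p \<le> d"
    using ex_awalk_node[of i j] by force
qed

lemma near_node: "near d (cycle_on vs) (node i) = node ` {i - int d..i + int d} - {node i}"
proof (intro set_eqI)
  fix v
  show "v \<in> near d (cycle_on vs) (node i) \<longleftrightarrow> v \<in> node ` {i - int d..i + int d} - {node i}"
  proof (cases "v \<in> set vs")
    case True
    then obtain j where "v = node j" by (rule nodeE)
    then have "node i \<rightarrow>\<^sup>*\<^bsub>with_proj (cycle_on vs)\<^esub> v"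
      using ex_awalk_node[of i j] by (auto intro: reachable_awalkI)
    then show ?thesis
      using True by (auto simp: near_def cycle_dist_le_iff ex_awalk_node_length_le_iff)
  qed (auto simp: near_def node_mem)
qed

end

lemma card_near:
  assumes "cycle_graph C" "2 * d < card (pverts C)" "u \<in> pverts C"
  shows "card (near d C u) = 2 * d"
proof -
  obtain vs where vs: "distinct vs" "3 \<le> length vs" and C: "C = cycle_on vs"
    using assms(1) by (rule cycle_graphE)
  interpret distinct_cycle vs using vs by unfold_locales auto
  obtain i where u: "u = node i" using assms(3) nodeE[of u 0] by (auto simp: C)
  have "2 * d < length vs" using assms(2) vs(1) by (simp add: C distinct_card)
  then have "inj_on node {i - int d..i + int d}"
    by (intro inj_on_subset[OF inj_on_node[of "i + int d + 1" "i - int d"]]) auto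
  then have "card (node ` {i - int d..i + int d}) = 2 * d + 1"
    by (simp add: card_image)
  then show ?thesis by (simp add: u C near_node card_Diff_singleton)
qed

subsection \<open>The ring network\<close>

lemma ring_network_simps [simp]:
  "pverts (ring_network d C) = pverts C"
  "parcs (ring_network d C) = Sigma (pverts C) (near d C)"
  by (auto simp: ring_network_def)

lemma ex_nonmember_in_window:
  fixes i j :: int
  assumes "i < j" "j \<notin> A" "card ({i<..<j} \<inter> A) < d"
  shows "\<exists>k. i < k \<and> k \<le> i + int d \<and> k \<le> j \<and> k \<notin> A"
proof (cases "j \<le> i + int d")
  case True
  then show ?thesis using assms(1,2) by blast
next
  case False
  have "\<not> {i<..i + int d} \<subseteq> {i<..<j} \<inter> A"
    using card_mono[of "{i<..<j} \<inter> A" "{i<..i + int d}"] assms(3) by auto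
  then obtain k where "k \<in> {i<..i + int d}" "k \<notin> {i<..<j} \<inter> A" by blast
  then show ?thesis using False by (intro exI[of _ k]) auto
qed

context distinct_cycle
begin

lemma node_ring_arc:
  assumes "\<bar>k - i\<bar> \<le> int d" "node k \<noteq> node i"
  shows "(node i, node k) \<in> parcs (ring_network d (cycle_on vs))"
proof -
  have "k \<in> {i - int d..i + int d}" using assms(1) by auto
  then show ?thesis using assms(2) by (simp add: near_node node_mem)
qed

lemma ring_network_reachable_if_few_deleted_between:
  assumes "i \<le> j" "node i \<notin> S" "node j \<notin> S" "card ({i<..<j} \<inter> node -` S) < d"
  shows "(node i, node j) \<in> rtrancl_on (set vs - S) (symcl (parcs (ring_network d (cycle_on vs))))"
  using assms
proof (induction "nat (j - i)" arbitrary: i rule: less_induct)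
  case less
  let ?R = "symcl (parcs (ring_network d (cycle_on vs)))"
  have i: "node i \<in> set vs - S" using less.prems(2) node_mem by simp
  show ?case
  proof (cases "i = j")
    case True
    then show ?thesis using i by simp
  next
    case False
    then obtain k where k: "i < k" "k \<le> i + int d" "k \<le> j" "node k \<notin> S"
      using ex_nonmember_in_window[of i j "node -` S" d] less.prems by auto
    have "card ({k<..<j} \<inter> node -` S) \<le> card ({i<..<j} \<inter> node -` S)"
      using k(1) by (intro card_mono) auto
    then have rest: "(node k, node j) \<in> rtrancl_on (set vs - S) ?R"
      using k less.prems by (intro less.hyps) auto
    show ?thesis
    proof (cases "node k = node i")
      case True
      then show ?thesis using rest by simp
    next
      case False
      then have "(node i, node k) \<in> ?R"
        using node_ring_arc[of k i d] k by (simp add: symcl_def)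
      then show ?thesis using rest i by (rule converse_rtrancl_on_into_rtrancl_on)
    qed
  qed
qed

lemma card_deleted_on_both_sides_le:
  assumes "finite S" "i \<le> j" "j < i + int (length vs)"
  shows "card ({i<..<j} \<inter> node -` S) + card ({j<..<i + int (length vs)} \<inter> node -` S) \<le> card S"
    (is "card ?A + card ?B \<le> _")
proof -
  have "card ?A + card ?B = card (?A \<union> ?B)" by (subst card_Un_disjoint) auto
  also have "\<dots> = card (node ` (?A \<union> ?B))"
    using assms(2,3)
    by (intro card_image[symmetric] inj_on_subset[OF inj_on_node[OF order.refl, of i]]) auto
  also have "\<dots> \<le> card S" by (intro card_mono assms(1)) auto
  finally show ?thesis .
qed

lemma connected_on_ring_network_Diff:
  assumes "finite S" "card S < 2 * d" "\<not> set vs \<subseteq> S"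
  shows "connected_on (ring_network d (cycle_on vs)) (set vs - S)"
  unfolding connected_on_iff
proof (intro conjI ballI)
  fix u v assume uv: "u \<in> set vs - S" "v \<in> set vs - S"
  let ?R = "rtrancl_on (set vs - S) (symcl (parcs (ring_network d (cycle_on vs))))"
  obtain i where i: "u = node i" using uv(1) by (blast elim: nodeE)
  obtain j where j: "v = node j" "i \<le> j" "j < i + int (length vs)"
    using uv(2) by (blast elim: nodeE)
  have u: "u = node (i + int (length vs))" by (simp add: i node_eq_iff)
  consider (clockwise) "card ({i<..<j} \<inter> node -` S) < d"
    | (counterclockwise) "card ({j<..<i + int (length vs)} \<inter> node -` S) < d"
    using card_deleted_on_both_sides_le[OF assms(1) j(2,3)] assms(2) by linarith
  then show "(u, v) \<in> ?R"
  proof cases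
    case clockwise
    then show ?thesis
      using uv j(2) unfolding i j(1) by (intro ring_network_reachable_if_few_deleted_between) auto
  next
    case counterclockwise
    then have "(v, u) \<in> ?R"
      using uv j(3) unfolding u j(1) by (intro ring_network_reachable_if_few_deleted_between) auto
    then show ?thesis using sym_rtrancl_on_symcl by (rule symD[rotated])
  qed
qed (use assms(3) in blast)

end

lemma vertex_connected_ring_network:
  assumes "cycle_graph C" "2 * d < card (pverts C)"
  shows "vertex_connected (2 * d) (ring_network d C)"
  unfolding vertex_connected_def
proof (intro conjI allI impI; (elim conjE)?)
  obtain vs where vs: "distinct vs" "3 \<le> length vs" and C: "C = cycle_on vs"
    using assms(1) by (rule cycle_graphE)
  interpret distinct_cycle vs using vs by unfold_locales auto
  fix S :: "'a set" assume S: "finite S" "card S < 2 * d"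
  then have "\<not> set vs \<subseteq> S" using assms(2) card_mono[of S "set vs"] by (auto simp: C)
  with S show "connected_on (ring_network d C) (pverts (ring_network d C) - S)"
    using connected_on_ring_network_Diff by (simp add: C)
qed (use assms(2) in simp)

lemma card_links_le_card_parcs:
  assumes "finite (parcs G)"
  shows "card (links G) \<le> card (parcs G)"
proof -
  have "links G = (\<lambda>(u, v). {u, v}) ` parcs G" by (auto simp: links_def)
  then show ?thesis using assms by (simp add: card_image_le)
qed

lemma card_links_ring_network_le:
  assumes "cycle_graph C" "2 * d < card (pverts C)"
  shows "card (links (ring_network d C)) \<le> card (pverts C) * (2 * d)"
proof -
  have fin: "finite (pverts C)" "finite (near d C u)" for u
    using finite_pverts_cycle_graph[OF assms(1)] by (simp_all add: near_def)
  then have "card (links (ring_network d C)) \<le> card (parcs (ring_network d C))"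
    by (intro card_links_le_card_parcs) simp
  also have "\<dots> = card (pverts C) * (2 * d)"
    using fin by (simp add: card_near[OF assms])
  finally show ?thesis .
qed

subsection \<open>Growing the network\<close>

inductive ring_growth :: "nat \<Rightarrow> 'a pair_pre_digraph \<Rightarrow> 'a pair_pre_digraph \<Rightarrow> bool" for d where
  ring: "cycle_graph C \<Longrightarrow> 2 * d < card (pverts C) \<Longrightarrow> ring_growth d C (ring_network d C)"
| step: "ring_growth d C G \<Longrightarrow> growth_step d C G C' G' \<Longrightarrow> ring_growth d C' G'"

lemma growth_stepE:
  assumes "growth_step d C G C' G'" "cycle_graph C" "2 * d < card (pverts C)"
  obtains x T where "x \<notin> pverts C" "cycle_graph C'" "pverts C' = insert x (pverts C)"
    "T \<subseteq> pverts C" "card T = 2 * d" "G' = attach_vertex x T G"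
proof -
  obtain x a b where x: "x \<notin> pverts C" "(a, b) \<in> parcs C" and C': "C' = subdivide C (a, b) x"
    and G': "G' = attach_vertex x (near d C' x) G"
    using assms(1) by (auto simp: growth_step_def attach_vertex_def)
  have cycle: "cycle_graph C'"
    unfolding C' using assms(2) x(2,1) by (rule cycle_graph_subdivide)
  have verts: "pverts C' = insert x (pverts C)" by (simp add: C')
  have "2 * d < card (pverts C')"
    using assms(3) card_insert_le[of "pverts C" x] by (simp add: verts)
  then have "card (near d C' x) = 2 * d" by (intro card_near cycle) (simp_all add: verts)
  moreover have "near d C' x \<subseteq> pverts C" by (auto simp: near_def verts)
  ultimately show thesis using that x(1) cycle verts G' by blast
qed

lemma ring_growth_cycle:
  assumes "ring_growth d C G"
  shows "cycle_graph C \<and> pverts G = pverts C \<and> 2 * d < card (pverts C)"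
  using assms
proof induction
  case (step C G C' G')
  then obtain x T where "cycle_graph C'" "pverts C' = insert x (pverts C)" "G' = attach_vertex x T G"
    by (meson growth_stepE)
  then show ?case
    using step.IH card_insert_le[of "pverts C" x] by simp
qed simp

lemma finite_pverts_ring_growth: "ring_growth d C G \<Longrightarrow> finite (pverts G)"
  by (auto dest: ring_growth_cycle simp: finite_pverts_cycle_graph)

lemma ring_growth_stepE:
  assumes "ring_growth d C G" "growth_step d C G C' G'"
  obtains x T where "x \<notin> pverts G" "T \<subseteq> pverts G" "card T = 2 * d" "G' = attach_vertex x T G"
  using assms(2) ring_growth_cycle[OF assms(1)] by (metis growth_stepE)

lemma vertex_connected_ring_growth:
  "ring_growth d C G \<Longrightarrow> vertex_connected (2 * d) G"
proof (induction rule: ring_growth.induct)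
  case (step C G C' G')
  obtain x T where "T \<subseteq> pverts G" "card T = 2 * d" "G' = attach_vertex x T G"
    using step.hyps by (rule ring_growth_stepE)
  then show ?case using step.IH by (simp add: vertex_connected_attach_vertex)
qed (rule vertex_connected_ring_network)

lemma card_links_ring_growth_le:
  "ring_growth d C G \<Longrightarrow> card (links G) \<le> card (pverts G) * (2 * d)"
proof (induction rule: ring_growth.induct)
  case (step C G C' G')
  obtain x T where x: "x \<notin> pverts G" and T: "T \<subseteq> pverts G" "card T = 2 * d"
    and G': "G' = attach_vertex x T G"
    using step.hyps by (rule ring_growth_stepE)
  have finite: "finite (pverts G)" using step.hyps(1) by (rule finite_pverts_ring_growth)
  have "card (links G') \<le> card (links G) + card T"
    unfolding G' using T(1) finite by (intro card_links_attach_vertex_le) (rule finite_subset)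
  also have "\<dots> \<le> card (pverts G') * (2 * d)"
    using step.IH T(2) x finite by (simp add: G')
  finally show ?case .
qed (simp add: card_links_ring_network_le)

lemma subgraph_growth_step:
  assumes "growth_step d C G C' G'" "wf_digraph (with_proj G)" "wf_digraph (with_proj G')"
  shows "subgraph (with_proj G) (with_proj G')"
  using assms by (auto simp: growth_step_def subgraph_def compatible_def)

lemma subgraph_chain:
  assumes "\<And>k. m \<le> k \<Longrightarrow> subgraph (H k) (H (Suc k))" "m \<le> i" "i \<le> j"
  shows "subgraph (H i) (H j)"
  using assms(3)
proof (induction j rule: dec_induct)
  case base
  then show ?case using assms(1)[OF assms(2)] by (simp add: subgraph_def compatible_def)
next
  case (step k)
  then show ?case using assms(1)[of k] assms(2) by (auto intro: subgraph_trans)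
qed

lemma ring_growth_sequence:
  assumes "cycle_graph (C m)" "2 * d < card (pverts (C m))" "G m = ring_network d (C m)"
    and "\<And>k. m \<le> k \<Longrightarrow> growth_step d (C k) (G k) (C (Suc k)) (G (Suc k))"
    and "m \<le> k"
  shows "ring_growth d (C k) (G k)"
  using assms(5)
proof (induction k rule: dec_induct)
  case base
  then show ?case using assms(1,2) by (simp add: assms(3) ring_growth.ring)
next
  case (step k)
  then show ?case using assms(4) by (auto intro: ring_growth.step)
qed

theorem theorem5:
  fixes Nf :: nat
    and G C :: "nat \<Rightarrow> 'a pair_pre_digraph"
  assumes "odd Nf" and "Nf > 0"
    and "\<And>k. k \<ge> 1 \<Longrightarrow> pair_graph (G k)"
    and "\<And>k. k \<ge> 2 \<Longrightarrow> card (pverts (G k)) = card (pverts (G (k - 1))) + 1"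
    and "\<And>k. k \<ge> 1 \<Longrightarrow> Nf + 2 < card (pverts (G k))"
    and "cycle_graph (C 1)"
    and "G 1 = ring_network ((Nf + 1) div 2) (C 1)"
    and "\<And>k. k \<ge> 2 \<Longrightarrow> growth_step ((Nf + 1) div 2) (C (k - 1)) (G (k - 1)) (C k) (G k)"
  shows "(\<forall>i j. 1 \<le> i \<and> i \<le> j \<longrightarrow> subgraph (with_proj (G i)) (with_proj (G j))) \<and>
         (\<forall>k\<ge>1. robust Nf (G k)) \<and>
         (\<forall>k\<ge>1. card (links (G k)) \<le> card (pverts (G k)) * (Nf + 1))"
proof -
  define d where "d = (Nf + 1) div 2"
  have d: "2 * d = Suc Nf" using assms(1) by (simp add: d_def)
  have growth: "growth_step d (C k) (G k) (C (Suc k)) (G (Suc k))" if "1 \<le> k" for k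
    using assms(8)[of "Suc k"] that by (simp add: d_def)
  have ring: "G 1 = ring_network d (C 1)" using assms(7) by (simp only: d_def)
  then have "2 * d < card (pverts (C 1))" using assms(5)[of 1] d by simp
  with assms(6) have grown: "ring_growth d (C k) (G k)" if "1 \<le> k" for k
    using ring growth that by (rule ring_growth_sequence)
  have "wf_digraph (with_proj (G k))" if "1 \<le> k" for k
    using pair_graph.axioms(1)[OF assms(3)[OF that]]
    by (simp add: wf_digraph_wp_iff pair_digraph.pair_wf_digraph)
  then have "subgraph (with_proj (G k)) (with_proj (G (Suc k)))" if "1 \<le> k" for k
    using growth[OF that] that by (intro subgraph_growth_step) auto
  then have "subgraph (with_proj (G i)) (with_proj (G j))" if "1 \<le> i" "i \<le> j" for i j
    using that by (rule subgraph_chain)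
  moreover have "robust Nf (G k)" if "1 \<le> k" for k
    using vertex_connected_ring_growth[OF grown[OF that]]
    by (simp only: d vertex_connected_imp_robust)
  moreover have "card (links (G k)) \<le> card (pverts (G k)) * (Nf + 1)" if "1 \<le> k" for k
    using card_links_ring_growth_le[OF grown[OF that]] by (simp add: d)
  ultimately show ?thesis by blast
qed

end
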